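(* Let $n \geq 1$ be an integer, and for $x \in [0,1]$ let $$F_n(x) = \sum_{k=0}^n \left( \binom{n}{k} x^k (1-x)^{n-k} \right)^2, \qquad R_n(x) = -\log F_n(x), \qquad T_n(x) = 1 - F_n(x).$$ Then $R_n$ is concave on $[0,1]$ and $T_n$ is log-concave on $[0,1]$.
   Context: The functions $R_n$ and $T_n$ are, respectively, the Rényi entropy and the Tsallis entropy of order 2 of the binomial distribution with parameters $n$ and $x$. The convention $0^0 = 1$ is used, so that $F_n(0) = F_n(1) = 1$ and $T_n(0) = T_n(1) = 0$; the function $F_n$ is strictly positive on $[0,1]$. A nonnegative function $f$ on an interval $I$ is called log-concave on $I$ if $f(\lambda x + (1-\lambda) y) \geq f(x)^{\lambda} f(y)^{1-\lambda}$ for all $x, y \in I$ and all $\lambda \in (0,1)$ (equivalently, $\log f$ is concave with the convention $\log 0 = -\infty$). *)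

theory Defs
  imports "HOL-Analysis.Analysis"
begin

definition binom_F :: "nat \<Rightarrow> real \<Rightarrow> real" where
  "binom_F n x = (\<Sum>k=0..n. (real (n choose k) * x ^ k * (1 - x) ^ (n - k))\<^sup>2)"

definition renyi2 :: "nat \<Rightarrow> real \<Rightarrow> real" where
  "renyi2 n x = - ln (binom_F n x)"

definition tsallis2 :: "nat \<Rightarrow> real \<Rightarrow> real" where
  "tsallis2 n x = 1 - binom_F n x"

(* The weights l and 1 - l are strictly positive and 0 powr a = 0, so a zero of f on I
   makes the right-hand side vanish, in accordance with the convention log 0 = -infinity. *)
definition log_concave_on :: "real set \<Rightarrow> (real \<Rightarrow> real) \<Rightarrow> bool" where
  "log_concave_on I f \<longleftrightarrow>
     is_interval I \<and> (\<forall>x\<in>I. 0 \<le> f x) \<and>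
     (\<forall>x\<in>I. \<forall>y\<in>I. \<forall>l. 0 < l \<and> l < 1 \<longrightarrow>
        f (l * x + (1 - l) * y) \<ge> f x powr l * f y powr (1 - l))"

(* ln is total in HOL; this positivity makes it the genuine logarithm in renyi2. *)
lemma binom_F_pos: "0 < binom_F n x"
proof -
  have "\<exists>k\<in>{0..n}. real (n choose k) * x ^ k * (1 - x) ^ (n - k) \<noteq> 0"
  proof (cases "x = 1")
    case True
    then show ?thesis by (intro bexI[of _ n]) auto
  next
    case False
    then show ?thesis by (intro bexI[of _ 0]) auto
  qed
  then obtain k where "k \<in> {0..n}" "real (n choose k) * x ^ k * (1 - x) ^ (n - k) \<noteq> 0"
    by blast
  then show ?thesis
    unfolding binom_F_def by (intro sum_pos2[of _ k]) simp_all
qed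

end

theory Submission
  imports Defs "HOL-Computational_Algebra.Polynomial"
begin

text \<open>The sum \<open>F\<^sub>n x = (\<Sum>k\<le>n. (n choose k)\<^sup>2 * a ^ k * b ^ (n - k))\<close> with \<open>a = x\<^sup>2\<close> and
  \<open>b = (1 - x)\<^sup>2\<close> satisfies the Legendre contiguity relations, so \<open>F\<^sub>n'\<close> and \<open>F\<^sub>n''\<close> are,
  on the open interval, combinations of \<open>F\<^sub>n\<close> and \<open>D = F\<^sub>n\<^sub>-\<^sub>1 - F\<^sub>n\<close>. With \<open>d = 4 * x * (1 - x)\<close>, the
  log-convexity of \<open>F\<^sub>n\<close> thereby becomes the nonnegativity of a quadratic form in \<open>F\<^sub>n\<close> and \<open>D\<close>,
  which the three-term recurrence propagates from \<open>n\<close> to \<open>n + 1\<close> together with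
  \<open>0 \<le> D\<close> and \<open>2 * (1 - d) * D \<le> d * F\<^sub>n\<close>. A log-convex \<open>F\<^sub>n\<close> is convex, so \<open>1 - F\<^sub>n\<close> is concave
  and nonnegative, hence log-concave.\<close>

section \<open>Homogeneous forms in two variables and their coefficient sequences\<close>

definition hsum :: "nat \<Rightarrow> (nat \<Rightarrow> real) \<Rightarrow> real \<Rightarrow> real \<Rightarrow> real" where
  "hsum n c a b = (\<Sum>k\<le>n. c k * a ^ k * b ^ (n - k))"

lemma hsum_cong: "(\<And>k. k \<le> n \<Longrightarrow> c k = c' k) \<Longrightarrow> hsum n c a b = hsum n c' a b"
  by (simp add: hsum_def)

lemma hsum_add: "hsum n (\<lambda>k. c k + c' k) a b = hsum n c a b + hsum n c' a b"
  by (simp add: hsum_def sum.distrib algebra_simps)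

lemma hsum_diff: "hsum n (\<lambda>k. c k - c' k) a b = hsum n c a b - hsum n c' a b"
  by (simp add: hsum_def sum_subtractf algebra_simps)

lemma hsum_cmult: "hsum n (\<lambda>k. r * c k) a b = r * hsum n c a b"
  by (simp add: hsum_def sum_distrib_left algebra_simps)

text \<open>The vanishing of \<open>c\<close> at \<open>Suc n\<close> lets one sequence serve in
  both degrees.\<close>

lemma hsum_mult_right:
  assumes "c (Suc n) = 0"
  shows "b * hsum n c a b = hsum (Suc n) c a b"
proof -
  have "hsum (Suc n) c a b = (\<Sum>k\<le>n. c k * a ^ k * b ^ (Suc n - k))"
    using assms by (simp add: hsum_def)
  also have "\<dots> = (\<Sum>k\<le>n. b * (c k * a ^ k * b ^ (n - k)))"
    by (intro sum.cong) (simp_all add: Suc_diff_le)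
  finally show ?thesis by (simp add: hsum_def sum_distrib_left)
qed

lemma hsum_mult_left:
  "a * hsum n c a b = hsum (Suc n) (\<lambda>k. if k = 0 then 0 else c (k - 1)) a b"
  unfolding hsum_def sum.atMost_Suc_shift by (simp add: sum_distrib_left mult_ac)

section \<open>Contiguity relations from squared binomial coefficients\<close>

definition binom_sq :: "nat \<Rightarrow> nat \<Rightarrow> real" where
  "binom_sq n k = (real (n choose k))\<^sup>2"

definition binom_sq_pred :: "nat \<Rightarrow> nat \<Rightarrow> real" where
  "binom_sq_pred n k = (if k = 0 then 0 else binom_sq n (k - 1))"

text \<open>Squared absorption identities. They make all coefficients at \<open>k\<close> multiples
  of \<open>binom_sq (Suc n) k\<close>, so a relation between forms reduces to a polynomial identity
  in \<open>n\<close> and \<open>k\<close>.\<close>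

lemma binom_sq_Suc:
  assumes "k \<le> Suc n"
  shows "(real (Suc n))\<^sup>2 * binom_sq n k = (real (Suc n) - real k)\<^sup>2 * binom_sq (Suc n) k"
    and "(real (Suc n))\<^sup>2 * binom_sq_pred n k = (real k)\<^sup>2 * binom_sq (Suc n) k"
proof -
  have up: "real (Suc n) * real (n choose (k - 1)) = real k * real (Suc n choose k)" if "k \<noteq> 0"
    using that Suc_times_binomial[of "k - 1" n] by (metis Suc_diff_1 not_gr_zero of_nat_mult)
  have "real (Suc n choose k) = real (n choose k) + (if k = 0 then 0 else real (n choose (k - 1)))"
    by (cases k) auto
  then have "real (Suc n) * real (n choose k) = (real (Suc n) - real k) * real (Suc n choose k)"
    using up by (cases "k = 0") (auto simp: algebra_simps simp del: of_nat_Suc)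
  then show "(real (Suc n))\<^sup>2 * binom_sq n k = (real (Suc n) - real k)\<^sup>2 * binom_sq (Suc n) k"
    by (simp only: binom_sq_def flip: power_mult_distrib)
  show "(real (Suc n))\<^sup>2 * binom_sq_pred n k = (real k)\<^sup>2 * binom_sq (Suc n) k"
    using up by (cases "k = 0")
      (simp add: binom_sq_pred_def, simp only: up binom_sq_def binom_sq_pred_def if_False not_False_eq_True flip: power_mult_distrib)
qed

lemma binom_sq_gt: "binom_sq n (Suc n) = 0"
  by (simp add: binom_sq_def)

text \<open>With \<open>N = Suc n\<close>, the coefficients agree because
  \<open>N^2 + k^2 - (N - k)^2 = 2 * N * k\<close>.\<close>

lemma binom_sq_first_moment:
  "2 * hsum (Suc n) (\<lambda>k. real k * binom_sq (Suc n) k) a b =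
     real (Suc n) * (hsum (Suc n) (binom_sq (Suc n)) a b + (a - b) * hsum n (binom_sq n) a b)"
proof -
  have coeff: "2 * (real k * binom_sq (Suc n) k) =
      real (Suc n) * (binom_sq (Suc n) k + (binom_sq_pred n k - binom_sq n k))"
    if "k \<le> Suc n" for k
  proof -
    have "(real (Suc n))\<^sup>2 * (2 * (real k * binom_sq (Suc n) k)) =
      (real (Suc n))\<^sup>2 * (real (Suc n) * (binom_sq (Suc n) k + (binom_sq_pred n k - binom_sq n k)))"
      using binom_sq_Suc[OF that] by algebra
    then show ?thesis by simp
  qed
  have "2 * hsum (Suc n) (\<lambda>k. real k * binom_sq (Suc n) k) a b =
      hsum (Suc n) (\<lambda>k. real (Suc n) * (binom_sq (Suc n) k + (binom_sq_pred n k - binom_sq n k))) a b"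
    unfolding hsum_cmult[symmetric] by (rule hsum_cong) (rule coeff)
  also have "\<dots> = real (Suc n) * (hsum (Suc n) (binom_sq (Suc n)) a b +
      (a * hsum n (binom_sq n) a b - b * hsum n (binom_sq n) a b))"
    using hsum_mult_right[of "binom_sq n", OF binom_sq_gt] hsum_mult_left[of a n "binom_sq n"]
    by (simp only: hsum_cmult hsum_add hsum_diff binom_sq_pred_def)
  finally show ?thesis by (simp add: algebra_simps)
qed

text \<open>With \<open>N = Suc n\<close>, the coefficients agree because
  \<open>(2 * k + N) * (N - k)^2 + (3 * N - 2 * k) * k^2 = N^3\<close>.\<close>

lemma binom_sq_step:
  "real (Suc n) * hsum (Suc n) (binom_sq (Suc n)) a b =
     2 * (b - a) * hsum n (\<lambda>k. real k * binom_sq n k) a b +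
     ((3 * real n + 1) * a + (real n + 1) * b) * hsum n (binom_sq n) a b"
proof -
  \<comment> \<open>On the right-hand side, \<open>u\<close> collects what is multiplied by
    \<open>b\<close> and \<open>v\<close> what is multiplied by \<open>a\<close>.\<close>
  define u where "u k = 2 * (real k * binom_sq n k) + (real n + 1) * binom_sq n k" for k
  define v where "v k = (3 * real n + 1) * binom_sq n k - 2 * (real k * binom_sq n k)" for k
  have coeff: "real (Suc n) * binom_sq (Suc n) k = u k + (if k = 0 then 0 else v (k - 1))"
    if "k \<le> Suc n" for k
  proof -
    have v: "(if k = 0 then 0 else v (k - 1)) = (3 * real (Suc n) - 2 * real k) * binom_sq_pred n k"
      by (auto simp: v_def binom_sq_pred_def algebra_simps of_nat_diff)
    have u: "u k = (2 * real k + real (Suc n)) * binom_sq n k"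
      by (simp add: u_def algebra_simps)
    have "(real (Suc n))\<^sup>2 * (real (Suc n) * binom_sq (Suc n) k) =
        (real (Suc n))\<^sup>2 * (u k + (if k = 0 then 0 else v (k - 1)))"
      unfolding u v using binom_sq_Suc[OF that] by algebra
    then show ?thesis by simp
  qed
  have "real (Suc n) * hsum (Suc n) (binom_sq (Suc n)) a b =
      hsum (Suc n) (\<lambda>k. u k + (if k = 0 then 0 else v (k - 1))) a b"
    unfolding hsum_cmult[symmetric] by (rule hsum_cong) (rule coeff)
  also have "\<dots> = b * hsum n u a b + a * hsum n v a b"
    using hsum_mult_right[of u n b a] hsum_mult_left[of a n v b] binom_sq_gt
    by (simp only: hsum_add u_def[of "Suc n"] mult_zero_right add_0)
  finally show ?thesis
    by (simp only: u_def[abs_def] v_def[abs_def] hsum_add hsum_diff hsum_cmult)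
      (simp add: algebra_simps)
qed

lemma binom_F_eq_hsum: "binom_F n x = hsum n (binom_sq n) (x\<^sup>2) ((1 - x)\<^sup>2)"
  by (simp add: binom_F_def hsum_def binom_sq_def atLeast0AtMost power_mult_distrib
      power_even_eq[symmetric] power_mult[symmetric] mult.commute)

text \<open>Up to the factor \<open>(1 - 2 * x) ^ n\<close>, this is the three-term recurrence of the
  Legendre polynomials.\<close>

lemma binom_F_recurrence:
  "real (Suc (Suc n)) * binom_F (Suc (Suc n)) x =
     (2 * real n + 3) * (x\<^sup>2 + (1 - x)\<^sup>2) * binom_F (Suc n) x
     - real (Suc n) * (1 - 2 * x)\<^sup>2 * binom_F n x"
proof -
  define a b where "a = x\<^sup>2" and "b = (1 - x)\<^sup>2"
  have ab: "(1 - 2 * x)\<^sup>2 = (a - b)\<^sup>2"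
    by (simp add: a_def b_def power2_eq_square algebra_simps)
  show ?thesis
    unfolding binom_F_eq_hsum ab a_def[symmetric] b_def[symmetric]
    using binom_sq_step[of "Suc n" a b] binom_sq_first_moment[of n a b]
    unfolding of_nat_Suc by algebra
qed

section \<open>Derivatives of \<open>binom_F\<close> through formal polynomials\<close>

definition binom_F_poly :: "nat \<Rightarrow> real poly" where
  "binom_F_poly n = (\<Sum>k\<le>n. smult (binom_sq n k) ([:0, 1:] ^ (2 * k) * [:1, -1:] ^ (2 * (n - k))))"

lemma poly_binom_F: "poly (binom_F_poly n) x = binom_F n x"
  by (simp add: binom_F_poly_def poly_sum binom_F_eq_hsum hsum_def power_mult mult.assoc)

text \<open>The factor \<open>x * (1 - x)\<close> restores the exponents lowered by differentiation,
  so no case \<open>i = 0\<close> or \<open>j = 0\<close> stands apart.\<close>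

lemma pderiv_monomial_product:
  "x * (1 - x) * poly (pderiv ([:0, 1:] ^ i * [:1, -1:] ^ j)) x =
     (real i * (1 - x) - real j * x) * (x ^ i * (1 - x) ^ j)" for x :: real
proof -
  have i: "x * poly (pderiv ([:0, 1:] ^ i)) x = real i * x ^ i"
    by (simp add: pderiv_power pderiv_pCons) (cases i; simp)
  have j: "(1 - x) * poly (pderiv ([:1, -1:] ^ j)) x = - real j * (1 - x) ^ j"
    by (simp add: pderiv_power pderiv_pCons) (cases j; simp)
  have "x * (1 - x) * poly (pderiv ([:0, 1:] ^ i * [:1, -1:] ^ j)) x =
      x * x ^ i * ((1 - x) * poly (pderiv ([:1, -1:] ^ j)) x) +
      (1 - x) * (1 - x) ^ j * (x * poly (pderiv ([:0, 1:] ^ i)) x)"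
    by (simp add: pderiv_mult algebra_simps)
  also have "\<dots> = (real i * (1 - x) - real j * x) * (x ^ i * (1 - x) ^ j)"
    unfolding i j by (simp add: algebra_simps)
  finally show ?thesis .
qed

lemma pderiv_binom_F_moment:
  "x * (1 - x) * poly (pderiv (binom_F_poly n)) x =
     2 * (hsum n (\<lambda>k. real k * binom_sq n k) (x\<^sup>2) ((1 - x)\<^sup>2) - real n * x * binom_F n x)"
proof -
  have "x * (1 - x) * poly (pderiv (binom_F_poly n)) x =
      (\<Sum>k\<le>n. binom_sq n k * (x * (1 - x) * poly (pderiv ([:0, 1:] ^ (2 * k) * [:1, -1:] ^ (2 * (n - k)))) x))"
    by (simp add: binom_F_poly_def higher_pderiv_sum[of "Suc 0", simplified] pderiv_smult poly_sum sum_distrib_left mult_ac)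
  also have "\<dots> = (\<Sum>k\<le>n. 2 * (real k * binom_sq n k - real n * x * binom_sq n k) *
      (x\<^sup>2) ^ k * ((1 - x)\<^sup>2) ^ (n - k))"
    unfolding pderiv_monomial_product unfolding power_mult
    by (intro sum.cong) (simp_all add: of_nat_diff algebra_simps)
  also have "\<dots> = hsum n (\<lambda>k. 2 * (real k * binom_sq n k - real n * x * binom_sq n k)) (x\<^sup>2) ((1 - x)\<^sup>2)"
    by (simp add: hsum_def)
  finally show ?thesis
    by (simp only: hsum_cmult hsum_diff binom_F_eq_hsum)
qed

lemma pderiv_binom_F_down:
  "x * (1 - x) * poly (pderiv (binom_F_poly (Suc n))) x =
     - real (Suc n) * (1 - 2 * x) * (binom_F n x - binom_F (Suc n) x)"
  using pderiv_binom_F_moment[of x "Suc n"] binom_sq_first_moment[of n "x\<^sup>2" "(1 - x)\<^sup>2"]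
  unfolding binom_F_eq_hsum[symmetric] by algebra

text \<open>\<open>binom_sq_step\<close> contains the first moment with factor
  \<open>2 * (b - a) = 2 * (1 - 2 * x)\<close>, whence the extra \<open>1 - 2 * x\<close> on the
  left.\<close>

lemma pderiv_binom_F_up:
  "x * (1 - x) * (1 - 2 * x) * poly (pderiv (binom_F_poly n)) x =
     real (Suc n) * (binom_F (Suc n) x - binom_F n x) + 2 * x * (1 - x) * binom_F n x"
  using pderiv_binom_F_moment[of x n] binom_sq_step[of n "x\<^sup>2" "(1 - x)\<^sup>2"]
  unfolding binom_F_eq_hsum[symmetric] of_nat_Suc by algebra

text \<open>Eliminating \<open>F\<^sub>n\<^sub>-\<^sub>1'\<close> from the derivative of \<open>pderiv_binom_F_down\<close> by means of
  \<open>pderiv_binom_F_up\<close> turns \<open>F\<^sub>n * F\<^sub>n'' - (F\<^sub>n')\<^sup>2\<close> into a multiple of the following form, with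
  \<open>m = n\<close>, \<open>F = F\<^sub>n\<close> and \<open>D = F\<^sub>n\<^sub>-\<^sub>1 - F\<^sub>n\<close>.\<close>

definition turan :: "real \<Rightarrow> real \<Rightarrow> real \<Rightarrow> real \<Rightarrow> real" where
  "turan m d F D = 2 * D * ((m * d + (1 - d)) * F - m * (1 - d) * D) - d * F\<^sup>2"

lemma pderiv2_binom_F:
  "(x * (1 - x))\<^sup>2 *
     (binom_F (Suc n) x * poly (pderiv (pderiv (binom_F_poly (Suc n)))) x
        - (poly (pderiv (binom_F_poly (Suc n))) x)\<^sup>2) =
   real (Suc n) / 2 * turan (real (Suc n)) (4 * x * (1 - x)) (binom_F (Suc n) x)
     (binom_F n x - binom_F (Suc n) x)"
proof -
  let ?p = "binom_F_poly (Suc n)" and ?q = "binom_F_poly n"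
  \<comment> \<open>The pointwise relation is lifted to polynomials so that it can be
    differentiated.\<close>
  have "[:0, 1, -1:] * pderiv ?p = smult (- real (Suc n)) ([:1, -2:] * (?q - ?p))"
    by (rule poly_ext) (use pderiv_binom_F_down[of _ n] in
      \<open>simp add: poly_binom_F algebra_simps power2_eq_square\<close>)
  then have "poly (pderiv ([:0, 1, -1:] * pderiv ?p)) x =
      poly (pderiv (smult (- real (Suc n)) ([:1, -2:] * (?q - ?p)))) x"
    by simp
  moreover have "poly (pderiv ([:0, 1, -1:] * r)) x =
      (1 - 2 * x) * poly r x + x * (1 - x) * poly (pderiv r) x" for r
    by (simp only: pderiv_mult poly_add poly_mult) (simp add: pderiv_pCons algebra_simps)
  moreover have "poly (pderiv (smult (- real (Suc n)) ([:1, -2:] * r))) x =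
      real (Suc n) * (2 * poly r x - (1 - 2 * x) * poly (pderiv r) x)" for r
    by (simp only: pderiv_smult pderiv_mult poly_add poly_mult poly_smult)
      (simp add: pderiv_pCons algebra_simps)
  ultimately have "(1 - 2 * x) * poly (pderiv ?p) x + x * (1 - x) * poly (pderiv (pderiv ?p)) x =
      real (Suc n) * (2 * (binom_F n x - binom_F (Suc n) x)
        - (1 - 2 * x) * (poly (pderiv ?q) x - poly (pderiv ?p) x))"
    by (simp only: pderiv_diff poly_diff poly_binom_F)
  \<comment> \<open>The derivative of \<open>?q\<close> occurs with the factor
    \<open>1 - 2 * x\<close> that \<open>pderiv_binom_F_up\<close> provides, so it is eliminated
    without division.\<close>
  then have "2 * ((x * (1 - x))\<^sup>2 *
     (binom_F (Suc n) x * poly (pderiv (pderiv ?p)) x - (poly (pderiv ?p) x)\<^sup>2)) =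
     real (Suc n) * turan (real (Suc n)) (4 * x * (1 - x)) (binom_F (Suc n) x)
     (binom_F n x - binom_F (Suc n) x)"
    using pderiv_binom_F_down[of x n] pderiv_binom_F_up[of x n]
    unfolding turan_def by algebra
  then show ?thesis by simp
qed

section \<open>Induction for the quadratic form\<close>

lemma turan_step:
  fixes m d F D :: real
  assumes "m \<ge> 0" "0 \<le> d" "d \<le> 1" "F > 0" "D \<ge> 0" "2 * (1 - d) * D \<le> d * F"
    and turan: "turan m d F D \<ge> 0"
    and F': "(m + 1) * F' = (m + 1 - d / 2) * F - m * (1 - d) * D"
  shows "F - F' \<ge> 0" "2 * (1 - d) * (F - F') \<le> d * F'" "turan (m + 1) d F' (F - F') \<ge> 0"
proof -
  define g where "g = m * (1 - d) * D"
  have g0: "g \<ge> 0" using assms by (simp add: g_def)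
  have "m * (2 * (1 - d) * D) \<le> m * (d * F)" by (intro mult_left_mono assms)
  then have g1: "g \<le> m * d * F / 2" by (simp add: g_def mult_ac)
  have D': "(m + 1) * (F - F') = d * F / 2 + g"
    using F' by (simp add: g_def algebra_simps)
  have "(m + 1) * (F - F') \<ge> 0" unfolding D' using assms g0 by simp
  then show "F - F' \<ge> 0" using \<open>m \<ge> 0\<close> by (simp add: zero_le_mult_iff)
  \<comment> \<open>After multiplication by \<open>m + 1\<close> and elimination of
    \<open>F'\<close>, the second claim reads
    \<open>(2 - d) * g \<le> d * F * (m + d / 2)\<close>.\<close>
  have "(2 - d) * g \<le> (2 - d) * (m * d * F / 2)" using g1 assms by (intro mult_left_mono) auto
  also have "\<dots> \<le> d * F * (m + d / 2)" using assms by (simp add: algebra_simps)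
  finally have "(2 - d) * g \<le> d * F * (m + d / 2)" .
  moreover have "(m + 1) * (2 * (1 - d) * (F - F')) = 2 * (1 - d) * (d * F / 2 + g)"
    by (metis D' mult.left_commute)
  moreover have "(m + 1) * (d * F') = d * ((m + 1 - d / 2) * F - g)"
    using F' by (simp add: g_def mult.left_commute)
  ultimately have "(m + 1) * (2 * (1 - d) * (F - F')) \<le> (m + 1) * (d * F')"
    by (simp add: algebra_simps)
  then show "2 * (1 - d) * (F - F') \<le> d * F'" using \<open>m \<ge> 0\<close> by simp
  \<comment> \<open>The new form is, up to positive factors, a nonnegative multiple of the old one plus a remainder
    that is affine in \<open>g\<close>, so it suffices to check the remainder at \<open>g = 0\<close> and \<open>g = m * d * F / 2\<close>.\<close>
  define c where "c = d ^ 3 / 4 + m * d * (1 - d) + m * d ^ 3 / 2"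
  have rest: "g * (m * d\<^sup>2 + 3 * d - 2) + F * c \<ge> 0"
  proof (cases "m * d\<^sup>2 + 3 * d - 2 \<ge> 0")
    case True
    then show ?thesis using g0 assms by (simp add: c_def)
  next
    case False
    have "0 \<le> F * (m\<^sup>2 * d ^ 3 / 2 + m * d\<^sup>2 / 2 + d ^ 3 / 4 + m * d ^ 3 / 2)"
      using assms by simp
    also have "\<dots> = (m * d * F / 2) * (m * d\<^sup>2 + 3 * d - 2) + F * c"
      by (simp add: c_def power2_eq_square power3_eq_cube field_simps)
    also have "\<dots> \<le> g * (m * d\<^sup>2 + 3 * d - 2) + F * c"
      using g1 False by (intro add_right_mono mult_right_mono_neg) auto
    finally show ?thesis .
  qed
  \<comment> \<open>The multiplier of the old form is chosen to match the coefficients of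
    \<open>g^2\<close>, which leaves a remainder affine in \<open>g\<close>.\<close>
  have "4 * ((m + 1)\<^sup>2 * turan (m + 1) d F' (F - F')) =
      4 * ((m + 2 - d / 2) * (m * (1 - d)) * turan m d F D + F * (g * (m * d\<^sup>2 + 3 * d - 2) + F * c))"
  proof -
    have "2 * ((m + 1) * F') = (2 * (m + 1) - d) * F - 2 * g" using F' by (simp add: g_def algebra_simps)
    moreover have "4 * c = d ^ 3 + 4 * m * d * (1 - d) + 2 * m * d ^ 3" by (simp add: c_def)
    moreover have "2 * (m + 2 - d / 2) = 2 * m + 4 - d" by simp
    ultimately show ?thesis using g_def unfolding turan_def by algebra
  qed
  also have "\<dots> \<ge> 0" using assms rest by simp
  finally show "turan (m + 1) d F' (F - F') \<ge> 0" using \<open>m \<ge> 0\<close> by (simp add: zero_le_mult_iff)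
qed

lemma binom_F_turan:
  fixes x :: real
  defines "d \<equiv> 4 * x * (1 - x)"
  assumes "0 \<le> x" "x \<le> 1"
  shows "binom_F n x - binom_F (Suc n) x \<ge> 0 \<and>
    2 * (1 - d) * (binom_F n x - binom_F (Suc n) x) \<le> d * binom_F (Suc n) x \<and>
    turan (real (Suc n)) d (binom_F (Suc n) x) (binom_F n x - binom_F (Suc n) x) \<ge> 0"
proof -
  have d0: "0 \<le> d" using assms by (simp add: d_def)
  have d_eq: "d = 1 - (1 - 2 * x)\<^sup>2" by (simp add: d_def power2_eq_square algebra_simps)
  then have d1: "d \<le> 1" by simp
  show ?thesis
  proof (induction n)
    case 0
    have F1: "binom_F (Suc 0) x = 1 - d / 2" and F0: "binom_F 0 x = 1"
      by (simp_all add: binom_F_def d_def power2_eq_square field_simps)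
    have "turan 1 d (1 - d / 2) (d / 2) = d ^ 3 / 4"
      by (simp add: turan_def power2_eq_square power3_eq_cube field_simps)
    moreover have "d ^ 3 / 4 \<ge> 0"
      using d0 by simp
    ultimately have "turan 1 d (1 - d / 2) (d / 2) \<ge> 0"
      by linarith
    moreover have "(2 - 2 * d) * d \<le> d * (1 - d / 2) * 2"
      using d0 by (simp add: algebra_simps)
    ultimately show ?case using d0 by (simp add: F0 F1)
  next
    case (Suc n)
    \<comment> \<open>The recurrence is rewritten with \<open>x^2 + (1 - x)^2 = 1 - d / 2\<close>
      and \<open>(1 - 2 * x)^2 = 1 - d\<close>.\<close>
    have "(real (Suc n) + 1) * binom_F (Suc (Suc n)) x =
        (real (Suc n) + 1 - d / 2) * binom_F (Suc n) x
        - real (Suc n) * (1 - d) * (binom_F n x - binom_F (Suc n) x)"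
      using binom_F_recurrence[of n x] by (simp add: d_def power2_eq_square field_simps)
    from turan_step[OF _ d0 d1 binom_F_pos _ _ _ this] Suc.IH show ?case
      by (simp add: add.commute)
  qed
qed

text \<open>The factor \<open>(x * (1 - x))^2\<close> cancels only on the open interval; continuity
  gives the endpoints.\<close>

lemma binom_F_log_convex:
  assumes "x \<in> {0..1}"
  shows "(poly (pderiv (binom_F_poly n)) x)\<^sup>2 \<le> binom_F n x * poly (pderiv (pderiv (binom_F_poly n))) x"
proof (cases n)
  case 0
  then show ?thesis by (simp add: binom_F_poly_def pderiv_smult)
next
  case (Suc m)
  let ?p = "binom_F_poly n"
  let ?h = "\<lambda>x. poly ?p x * poly (pderiv (pderiv ?p)) x - (poly (pderiv ?p) x)\<^sup>2"
  have "?h y \<ge> 0" if "y \<in> {0<..<1}" for y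
  proof -
    have "(y * (1 - y))\<^sup>2 * ?h y \<ge> 0"
      unfolding Suc poly_binom_F pderiv2_binom_F using binom_F_turan[of y m] that
      by (intro mult_nonneg_nonneg) auto
    then show ?thesis using that by (simp add: zero_le_mult_iff)
  qed
  moreover have "continuous_on (closure {0<..<1}) ?h" by (intro continuous_intros)
  ultimately have "?h x \<ge> 0"
    using continuous_ge_on_closure[of "{0<..<1}" ?h x 0] assms by simp
  then show ?thesis by (simp add: poly_binom_F)
qed

section \<open>Concavity of the two entropies\<close>

lemma has_derivative_binom_F:
  "(binom_F n has_real_derivative poly (pderiv (binom_F_poly n)) x) (at x)"
  using poly_DERIV[of "binom_F_poly n" x] by (simp add: poly_binom_F)

lemma concave_on_renyi2: "concave_on {0..1} (renyi2 n)"
proof -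
  let ?p = "binom_F_poly n"
  have "convex_on {0..1} (\<lambda>x. ln (binom_F n x))"
  proof (rule f''_ge0_imp_convex)
    fix x :: real assume x: "x \<in> {0..1}"
    note pos = binom_F_pos[of n x]
    show "((\<lambda>x. ln (binom_F n x)) has_real_derivative poly (pderiv ?p) x / binom_F n x) (at x)"
      using pos by (auto intro!: derivative_eq_intros has_derivative_binom_F)
    show "((\<lambda>x. poly (pderiv ?p) x / binom_F n x) has_real_derivative
        (poly (pderiv (pderiv ?p)) x * binom_F n x - poly (pderiv ?p) x * poly (pderiv ?p) x)
          / (binom_F n x * binom_F n x)) (at x)"
      using pos by (intro DERIV_divide poly_DERIV has_derivative_binom_F) simp
    show "0 \<le> (poly (pderiv (pderiv ?p)) x * binom_F n x - poly (pderiv ?p) x * poly (pderiv ?p) x)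
          / (binom_F n x * binom_F n x)"
      using binom_F_log_convex[OF x, of n] pos
      by (intro divide_nonneg_pos) (simp_all add: power2_eq_square mult.commute)
  qed simp
  then show ?thesis by (simp add: concave_on_def renyi2_def)
qed

lemma convex_on_binom_F: "convex_on {0..1} (binom_F n)"
proof (rule f''_ge0_imp_convex)
  fix x :: real assume x: "x \<in> {0..1}"
  have "0 \<le> binom_F n x * poly (pderiv (pderiv (binom_F_poly n))) x"
    using binom_F_log_convex[OF x, of n] zero_le_power2 order_trans by blast
  then show "0 \<le> poly (pderiv (pderiv (binom_F_poly n))) x"
    using binom_F_pos[of n x] by (simp add: zero_le_mult_iff)
qed (auto intro: has_derivative_binom_F poly_DERIV)

text \<open>Weighted AM-GM bounds the geometric mean of two values by the arithmetic mean, which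
  concavity bounds in turn.\<close>

lemma log_concave_on_concave:
  fixes f :: "real \<Rightarrow> real"
  assumes "concave_on I f" and nonneg: "\<And>x. x \<in> I \<Longrightarrow> 0 \<le> f x"
  shows "log_concave_on I f"
  unfolding log_concave_on_def
proof (intro conjI ballI allI impI nonneg)
  show "is_interval I"
    using assms(1) by (simp add: concave_on_iff is_interval_convex_1)
  fix x y l :: real
  assume xy: "x \<in> I" "y \<in> I" and l: "0 < l \<and> l < 1"
  have "f x powr l * f y powr (1 - l) \<le> l * f x + (1 - l) * f y"
  proof (cases "f x = 0 \<or> f y = 0")
    case True
    then show ?thesis using nonneg xy l by auto
  next
    case False
    then show ?thesis
      using Youngs_inequality_0[of l "1 - l" "f x" "f y"] nonneg[of x] nonneg[of y] xy l by simp
  qed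
  also have "\<dots> \<le> f (l * x + (1 - l) * y)"
    using assms(1) xy l unfolding concave_on_iff by simp
  finally show "f x powr l * f y powr (1 - l) \<le> f (l * x + (1 - l) * y)" .
qed

lemma log_concave_on_tsallis2: "log_concave_on {0..1} (tsallis2 n)"
proof (rule log_concave_on_concave)
  have "convex_on {0..1} (\<lambda>x. binom_F n x - 1)"
    by (intro convex_on_diff convex_on_binom_F) (simp add: concave_on_const)
  then show "concave_on {0..1} (tsallis2 n)"
    by (simp add: concave_on_def tsallis2_def[abs_def])
  fix x :: real assume x: "x \<in> {0..1}"
  \<comment> \<open>A convex function lies below its chord, here the constant 1, so
    \<open>binom_F n x \<le> 1\<close>.\<close>
  have "binom_F n 0 = 1"
    by (simp add: binom_F_def atLeast0AtMost sum.atMost_shift)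
  moreover have "binom_F n 1 = 1"
    by (simp add: binom_F_def atLeast0AtMost power_0_left flip: lessThan_Suc_atMost)
  ultimately show "0 \<le> tsallis2 n x"
    using convex_onD[OF convex_on_binom_F, of x 0 1 n] x by (simp add: tsallis2_def)
qed

theorem corollary2p2:
  fixes n :: nat
  assumes "n \<ge> 1"
  shows "concave_on {0..1} (renyi2 n) \<and> log_concave_on {0..1} (tsallis2 n)"
  using concave_on_renyi2 log_concave_on_tsallis2 by blast

end
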